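(* Consider a hierarchical convex game $\mathscr{G}$ with $\mathbf{N}$ players, its smoothed counterparts $\mathscr{G}_\eta$ ($\eta>0$), and a sequence $\{\mathbf{x}_\eta\}$, where $\mathbf{x}_\eta\in\mathcal{X}$ is a Nash equilibrium of $\mathscr{G}_\eta$, converging to some $\mathbf{x}\in\mathcal{X}$ as $\eta\downarrow0$. For $i=1,\dots,\mathbf{N}$, suppose $f_i(\cdot,\mathbf{x}^{-i})$ is a strongly lower semicontinuous function on $\mathcal{X}_i$ for every $\mathbf{x}^{-i}\in\mathcal{X}_{-i}$, and $f_i(\mathbf{x}^i,\cdot)$ is a continuous function for every $\mathbf{x}^i\in\mathcal{X}_i$. Then $\mathbf{x}$ is a Nash equilibrium of $\mathscr{G}$.
   Context: Game $\mathscr{G}$: player $i$ minimizes $f_i(\cdot,\mathbf{x}^{-i})$ over a closed convex set $\mathcal{X}_i\subseteq\mathbb{R}^{n_i}$, with $\mathcal{X}=\prod_i\mathcal{X}_i$, $\mathcal{X}_{-i}=\prod_{j\ne i}\mathcal{X}_j$. Here $f_i(\mathbf{x}^i,\mathbf{x}^{-i})=\mathbb{E}[\tilde f_i(\mathbf{x}^i,\mathbf{y}^i(\mathbf{x},\omega),\mathbf{x}^{-i},\omega)]$ with $\mathbf{y}^i(\mathbf{x},\omega)$ the unique solution of a lower-level parametrized variational inequality $\mathrm{VI}(\mathcal{Y}_i,F_i(\cdot,\mathbf{x},\omega))$ with $F_i(\cdot,\mathbf{x},\omega)$ strongly monotone. The game is hierarchical convex: $f_i(\cdot,\mathbf{x}^{-i})$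 is convex on $\mathcal{X}_i$ for every $\mathbf{x}^{-i}\in\mathcal{X}_{-i}$. Smoothing: $f_{i,\eta}(\mathbf{x}^i,\mathbf{x}^{-i})=\mathbb{E}_{u_i}[f_i(\mathbf{x}^i+\eta u_i,\mathbf{x}^{-i})]$ with $u_i$ uniform on the unit ball of $\mathbb{R}^{n_i}$; $\mathscr{G}_\eta$ is the game in which player $i$ minimizes $f_{i,\eta}(\cdot,\mathbf{x}^{-i})$ over $\mathcal{X}_i$. Standing assumption: there is $\mathcal{L}_0$ with $\|\tilde d\|\le\mathcal{L}_0$ for all $\mathbf{x}\in\mathcal{X}$, $\tilde d\in\partial_{\mathbf{x}^i}f_i(\mathbf{x}^i,\mathbf{x}^{-i})$ and all $i$. Standing facts: there exist $\alpha_i,\beta_i>0$ (independent of $\eta$) such that $f_{i,\eta}(\cdot,\mathbf{x}^{-i})$ is convex with $\tfrac{\alpha_i}{\eta}$-Lipschitz gradient on $\mathcal{X}_i$, and $f_i(\mathbf{x})\le f_{i,\eta}(\mathbf{x})\le f_i(\mathbf{x})+\eta\beta_i$ for all $\mathbf{x}\in\mathcal{X}$. A function $f$ is strongly lower semicontinuous at a point $x$ if it is lower semicontinuous at $x$ and there is a sequence $x_k\to x$ with $f$ continuous at each $x_k$ and $f(x_k)\to f(x)$; it is strongly lower semicontinuous on a set if this holds at every point of the set. *)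

theory Defs
  imports "HOL-Probability.Probability"
begin

text \<open>
  A profile is a vector of type \<open>'a ^ 'p\<close>: the players form the finite type \<open>'p\<close>, and
  \<open>x $ i\<close> is the strategy of player \<open>i\<close>.  Since the dimension of the strategy space depends
  on the player, player \<open>i\<close> is given a nonempty set \<open>B i \<subseteq> Basis\<close> of coordinates of one ambient
  Euclidean space \<open>'a\<close>, and \<open>span (B i)\<close>, of dimension \<open>card (B i)\<close>, plays the role of the
  player's own Euclidean space.
\<close>

definition play :: "'p::finite \<Rightarrow> 'a \<Rightarrow> 'a ^ 'p \<Rightarrow> 'a ^ 'p" where
  "play i y x = (\<chi> j. if j = i then y else x $ j)"

definition profiles :: "('p::finite \<Rightarrow> 'a set) \<Rightarrow> ('a ^ 'p) set" where
  "profiles X = {x. \<forall>j. x $ j \<in> X j}"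

text \<open>
  The product of the strategy sets of the rivals of \<open>i\<close>, as a cylinder: component \<open>i\<close> is
  unconstrained, and is always overwritten by \<^const>\<open>play\<close> where this set is used.
\<close>

definition rival_profiles :: "('p::finite \<Rightarrow> 'a set) \<Rightarrow> 'p \<Rightarrow> ('a ^ 'p) set" where
  "rival_profiles X i = {x. \<forall>j. j \<noteq> i \<longrightarrow> x $ j \<in> X j}"

text \<open>
  The profiles at which the cost of player \<open>i\<close> is used: smoothing moves the player's own
  strategy out of \<open>X i\<close>, but not out of the player's Euclidean space.
\<close>

definition cost_domain ::
    "('p::finite \<Rightarrow> 'a::euclidean_space set) \<Rightarrow> ('p \<Rightarrow> 'a set) \<Rightarrow> 'p \<Rightarrow> ('a ^ 'p) set" where
  "cost_domain B X i = {x \<in> rival_profiles X i. x $ i \<in> span (B i)}"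

definition nash_equilibrium ::
    "('p::finite \<Rightarrow> 'a set) \<Rightarrow> ('p \<Rightarrow> 'a ^ 'p \<Rightarrow> real) \<Rightarrow> 'a ^ 'p \<Rightarrow> bool" where
  "nash_equilibrium X f x \<longleftrightarrow>
     x \<in> profiles X \<and> (\<forall>i. \<forall>y\<in>X i. f i x \<le> f i (play i y x))"

definition VI_solution :: "'b::real_inner set \<Rightarrow> ('b \<Rightarrow> 'b) \<Rightarrow> 'b \<Rightarrow> bool" where
  "VI_solution Y G y \<longleftrightarrow> y \<in> Y \<and> (\<forall>z\<in>Y. 0 \<le> G y \<bullet> (z - y))"

definition strongly_monotone_on :: "'b::real_inner set \<Rightarrow> ('b \<Rightarrow> 'b) \<Rightarrow> bool" where
  "strongly_monotone_on Y G \<longleftrightarrow>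
     (\<exists>c>0. \<forall>y\<in>Y. \<forall>z\<in>Y. c * (norm (y - z))\<^sup>2 \<le> (G y - G z) \<bullet> (y - z))"

text \<open>Meaningful only where the variational inequality has exactly one solution.\<close>

definition lower_level ::
    "('p \<Rightarrow> 'b::real_inner set) \<Rightarrow> ('p \<Rightarrow> 'b \<Rightarrow> 'a ^ 'p \<Rightarrow> 'w \<Rightarrow> 'b) \<Rightarrow>
     'p::finite \<Rightarrow> 'a ^ 'p \<Rightarrow> 'w \<Rightarrow> 'b" where
  "lower_level Y F i x \<omega> = (THE y. VI_solution (Y i) (\<lambda>z. F i z x \<omega>) y)"

definition hierarchical_cost ::
    "'w measure \<Rightarrow> ('p \<Rightarrow> 'b::real_inner set) \<Rightarrow> ('p \<Rightarrow> 'b \<Rightarrow> 'a ^ 'p \<Rightarrow> 'w \<Rightarrow> 'b) \<Rightarrow>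
     ('p \<Rightarrow> 'a ^ 'p \<Rightarrow> 'b \<Rightarrow> 'w \<Rightarrow> real) \<Rightarrow> 'p::finite \<Rightarrow> 'a ^ 'p \<Rightarrow> real" where
  "hierarchical_cost M Y F ft i x = (\<integral>\<omega>. ft i x (lower_level Y F i x \<omega>) \<omega> \<partial>M)"

text \<open>
  Lebesgue measure of the subspace \<open>span B\<close>, as a measure on the ambient space; this is the
  library's construction of \<^const>\<open>lborel\<close> with \<open>Basis\<close> replaced by the set \<open>B\<close> of coordinates.
\<close>

definition coord_lborel :: "'a::euclidean_space set \<Rightarrow> 'a measure" where
  "coord_lborel B = distr (\<Pi>\<^sub>M b\<in>B. lborel) borel (\<lambda>w. \<Sum>b\<in>B. w b *\<^sub>R b)"

lemma coord_lborel_Basis: "coord_lborel (Basis :: 'a::euclidean_space set) = lborel"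
  unfolding coord_lborel_def by (simp only: lborel_eq_real lborel_def[where ?'a = 'a])

definition unit_ball_uniform :: "'a::euclidean_space set \<Rightarrow> 'a measure" where
  "unit_ball_uniform B = uniform_measure (coord_lborel B) (cball 0 1 \<inter> span B)"

definition smoothed ::
    "('p::finite \<Rightarrow> 'a::euclidean_space set) \<Rightarrow> ('p \<Rightarrow> 'a ^ 'p \<Rightarrow> real) \<Rightarrow> real \<Rightarrow>
     'p \<Rightarrow> 'a ^ 'p \<Rightarrow> real" where
  "smoothed B f \<eta> i x = (\<integral>u. f i (play i (x $ i + \<eta> *\<^sub>R u) x) \<partial>unit_ball_uniform (B i))"

definition subdifferential ::
    "'a::real_inner set \<Rightarrow> ('a \<Rightarrow> real) \<Rightarrow> 'a \<Rightarrow> 'a set" where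
  "subdifferential E g x = {d \<in> E. \<forall>z\<in>E. g x + d \<bullet> (z - x) \<le> g z}"

text \<open>
  The gradient is taken in the subspace \<open>E\<close>; it is uniquely determined, because it lies in \<open>E\<close>
  and differentiation is restricted to \<open>E\<close>.
\<close>

definition lipschitz_gradient_on ::
    "'a::real_inner set \<Rightarrow> real \<Rightarrow> 'a set \<Rightarrow> ('a \<Rightarrow> real) \<Rightarrow> bool" where
  "lipschitz_gradient_on E L S g \<longleftrightarrow>
     (\<exists>D. (\<forall>y\<in>S. D y \<in> E \<and> (g has_derivative (\<lambda>h. D y \<bullet> h)) (at y within E))
        \<and> L-lipschitz_on S D)"

definition lsc_within :: "'a::t2_space set \<Rightarrow> ('a \<Rightarrow> real) \<Rightarrow> 'a \<Rightarrow> bool" where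
  "lsc_within S g x \<longleftrightarrow> (\<forall>c<g x. \<forall>\<^sub>F y in at x within S. c < g y)"

definition strongly_lsc_on :: "'a::t2_space set \<Rightarrow> ('a \<Rightarrow> real) \<Rightarrow> bool" where
  "strongly_lsc_on S g \<longleftrightarrow>
     (\<forall>x\<in>S. lsc_within S g x \<and>
        (\<exists>s :: nat \<Rightarrow> 'a. (\<forall>k. s k \<in> S \<and> continuous (at (s k) within S) g)
           \<and> s \<longlonglongrightarrow> x \<and> (\<lambda>k. g (s k)) \<longlonglongrightarrow> g x))"

end

theory Submission
  imports Defs
begin

text \<open>
  In the equilibrium inequalities the smoothing error \<open>\<eta> k * \<beta> i\<close> vanishes, and continuity in the
  rivals' strategies lets the deviation side converge; what remains is a joint lower bound
  \<open>f i x \<le> lim inf f i (xs k)\<close>, although \<open>f i\<close> is only separately semicontinuous.  Convexity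
  supplies it.  The convex functions \<open>g k = (\<lambda>y. f i (play i y (xs k)))\<close> converge pointwise, hence
  are uniformly bounded above near some relative interior point \<open>w\<close>.  The point
  \<open>(1 - \<mu>) x + \<mu> w\<close> is also a convex combination of \<open>xs k $ i\<close> and a point near \<open>w\<close>, so
  the limit function is bounded there by \<open>(1 - \<mu>) m + \<mu> C\<close>, where \<open>m\<close> bounds the limit of
  \<open>g k (xs k $ i)\<close>; finally \<open>\<mu> \<down> 0\<close> along a segment, where lower semicontinuity applies.
\<close>

text \<open>If \<open>m < g x\<close>, a number \<open>d\<close> strictly between them would
  eventually lie below \<open>g (z n)\<close> by semicontinuity and above \<open>c n\<close> by
  convergence.\<close>

lemma lsc_within_le_lim:
  fixes g :: "'a::t2_space \<Rightarrow> real"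
  assumes lsc: "lsc_within S g x"
    and z: "z \<longlonglongrightarrow> x" "\<And>n. z n \<in> S"
    and le: "\<And>n. g (z n) \<le> c n" and c: "c \<longlonglongrightarrow> m"
  shows "g x \<le> m"
proof (rule ccontr)
  assume "\<not> g x \<le> m"
  then obtain d where d: "m < d" "d < g x"
    using dense[of m "g x"] by (auto simp: not_le)
  then have "\<forall>\<^sub>F y in at x within S. d < g y"
    using lsc unfolding lsc_within_def by blast
  then obtain T where T: "open T" "x \<in> T" "\<And>y. y \<in> T \<Longrightarrow> y \<noteq> x \<Longrightarrow> y \<in> S \<Longrightarrow> d < g y"
    unfolding eventually_at_topological by blast
  have "\<forall>\<^sub>F n in sequentially. z n \<in> T"
    using z(1) T(1,2) by (rule topological_tendstoD)
  moreover have "\<forall>\<^sub>F n in sequentially. c n < d"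
    using c d(1) by (rule order_tendstoD)
  ultimately have "\<forall>\<^sub>F n in sequentially. False"
  proof eventually_elim
    case (elim n)
    \<comment> \<open>The filter \<open>at x within S\<close> says nothing about \<open>x\<close>
      itself; terms with \<open>z n = x\<close> are covered by \<open>d < g x\<close>.\<close>
    then have "d < g (z n)"
      using T(3) z(2) d(2) by (cases "z n = x") auto
    then show False
      using le[of n] elim by linarith
  qed
  then show False by simp
qed

text \<open>An affine basis of \<open>S\<close> spans a simplex that is full-dimensional relative to
  \<open>S\<close>. Finiteness of \<open>V\<close> will turn pointwise convergence at the vertices
  into a bound uniform in the index.\<close>

lemma convex_contains_relative_simplex:
  fixes S :: "'a::euclidean_space set"
  assumes "convex S" "S \<noteq> {}"
  obtains V w where "finite V" "V \<subseteq> S" "w \<in> rel_interior (convex hull V)"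
    "affine hull (convex hull V) = affine hull S"
proof -
  obtain V where V: "V \<subseteq> S" "\<not> affine_dependent V" "affine hull S = affine hull V"
    using affine_basis_exists by blast
  have "V \<noteq> {}"
    using V(3) assms(2) by auto
  then have "rel_interior (convex hull V) \<noteq> {}"
    by (simp add: rel_interior_eq_empty)
  then show ?thesis
    using that aff_independent_finite[OF V(2)] V(1,3) by auto
qed

text \<open>Since \<open>x\<close> may lie on the relative boundary of \<open>S\<close>, the
  \<open>G k\<close> need not be equicontinuous near it; an upper bound near a relative interior
  point is carried towards \<open>x\<close> by convexity instead.\<close>

lemma convex_pointwise_lim_lsc_le:
  fixes G :: "nat \<Rightarrow> 'a::euclidean_space \<Rightarrow> real"
  assumes S: "convex S"
    and G: "\<And>k. convex_on S (G k)" "\<And>y. y \<in> S \<Longrightarrow> (\<lambda>k. G k y) \<longlonglongrightarrow> g y"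
    and y: "\<And>k. y k \<in> S" "y \<longlonglongrightarrow> x" "x \<in> S"
    and lsc: "lsc_within S g x"
    and le: "\<And>k. G k (y k) \<le> c k" and c: "c \<longlonglongrightarrow> m"
  shows "g x \<le> m"
proof -
  obtain V w where V: "finite V" "V \<subseteq> S" and w: "w \<in> rel_interior (convex hull V)"
    and aff: "affine hull (convex hull V) = affine hull S"
    using convex_contains_relative_simplex[OF S] y(3) by blast
  have hull_S: "convex hull V \<subseteq> S"
    using V(2) S by (rule hull_minimal)
  have wS: "w \<in> S"
    using w rel_interior_subset hull_S by blast
  \<comment> \<open>The \<open>+ 1\<close> is the slack that pointwise convergence leaves at each
    vertex; the absolute values make every summand at most the sum.\<close>
  define C where "C = (\<Sum>v\<in>V. \<bar>g v\<bar> + 1)"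
  have bound: "\<forall>\<^sub>F k in sequentially. \<forall>u\<in>convex hull V. G k u \<le> C"
  proof -
    have "\<forall>\<^sub>F k in sequentially. \<forall>v\<in>V. G k v < g v + 1"
      using V G(2) by (intro eventually_ball_finite ballI order_tendstoD(2)[of _ "g _"]) auto
    then show ?thesis
    proof eventually_elim
      case (elim k)
      have "G k v \<le> C" if "v \<in> V" for v
        using elim that member_le_sum[of v V "\<lambda>v. \<bar>g v\<bar> + 1"] V(1) unfolding C_def by fastforce
      moreover have "convex_on (convex hull V) (G k)"
        using G(1) hull_S by (meson convex_on_subset convex_convex_hull)
      ultimately show ?case
        by (intro convex_on_convex_hull_bound) auto
    qed
  qed
  obtain r where r: "r > 0" "ball w r \<inter> affine hull S \<subseteq> convex hull V"
    using w unfolding mem_rel_interior_ball aff by blast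
  have segment: "g ((1 - \<mu>) *\<^sub>R x + \<mu> *\<^sub>R w) \<le> (1 - \<mu>) * m + \<mu> * C"
    if \<mu>: "0 < \<mu>" "\<mu> < 1" for \<mu>
  proof -
    define z where "z = (1 - \<mu>) *\<^sub>R x + \<mu> *\<^sub>R w"
    define t where "t = (1 - \<mu>) / \<mu>"
    \<comment> \<open>chosen so that \<open>z = (1 - \<mu>) y k + \<mu> (u k)\<close>\<close>
    define u where "u k = w + t *\<^sub>R (x - y k)" for k
    have zS: "z \<in> S"
      unfolding z_def using S y(3) wS \<mu> by (intro convexD) auto
    have "u \<longlonglongrightarrow> w + t *\<^sub>R (x - x)"
      unfolding u_def by (intro tendsto_intros y(2))
    then have "\<forall>\<^sub>F k in sequentially. u k \<in> ball w r"
      using r(1) by (intro topological_tendstoD[where l = w]) auto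
    then have "\<forall>\<^sub>F k in sequentially. G k z \<le> (1 - \<mu>) * c k + \<mu> * C"
      using bound
    proof eventually_elim
      case (elim k)
      \<comment> \<open>Moving from \<open>w\<close> along \<open>x - y k\<close> could leave
        \<open>S\<close>, but not its affine hull; closeness to \<open>w\<close> then puts
        \<open>u k\<close> into the simplex.\<close>
      have "u k \<in> affine hull S"
        unfolding u_def using wS y(1)[of k] y(3)
        by (intro mem_affine_3_minus affine_affine_hull hull_inc)
      then have u_hull: "u k \<in> convex hull V"
        using r(2) elim(1) by blast
      have z_eq: "z = (1 - \<mu>) *\<^sub>R y k + \<mu> *\<^sub>R u k"
      proof -
        have "\<mu> * t = 1 - \<mu>"
          unfolding t_def using \<mu> by simp
        then show ?thesis
          unfolding z_def u_def by (simp add: scaleR_add_right scaleR_diff_right)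
      qed
      have "G k z \<le> (1 - \<mu>) * G k (y k) + \<mu> * G k (u k)"
        unfolding z_eq using \<mu> y(1) u_hull hull_S by (intro convex_onD[OF G(1)]) auto
      also have "\<dots> \<le> (1 - \<mu>) * c k + \<mu> * C"
        using \<mu> le elim(2) u_hull by (intro add_mono mult_left_mono) auto
      finally show ?case .
    qed
    \<comment> \<open>Let \<open>k\<close> tend to infinity with \<mu>, and hence \<open>z\<close>,
      fixed.\<close>
    then show ?thesis
      unfolding z_def[symmetric]
      by (intro tendsto_le[OF _ _ G(2)[OF zS]]) (auto intro!: tendsto_intros c)
  qed
  \<comment> \<open>The second \<open>Suc\<close> keeps the value at \<open>n = 0\<close> strictly
    below 1, as \<open>segment\<close> demands.\<close>
  define \<mu> :: "nat \<Rightarrow> real" where "\<mu> n = inverse (real (Suc (Suc n)))" for n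
  have \<mu>: "0 < \<mu> n" "\<mu> n < 1" for n
    unfolding \<mu>_def by (auto simp: field_simps)
  have lim: "\<mu> \<longlonglongrightarrow> 0"
    unfolding \<mu>_def by (rule LIMSEQ_Suc[OF LIMSEQ_inverse_real_of_nat])
  show ?thesis
  proof (rule lsc_within_le_lim[OF lsc])
    have "(\<lambda>n. (1 - \<mu> n) *\<^sub>R x + \<mu> n *\<^sub>R w) \<longlonglongrightarrow> (1 - 0) *\<^sub>R x + 0 *\<^sub>R w"
      by (intro tendsto_intros lim)
    then show "(\<lambda>n. (1 - \<mu> n) *\<^sub>R x + \<mu> n *\<^sub>R w) \<longlonglongrightarrow> x" by simp
    show "(1 - \<mu> n) *\<^sub>R x + \<mu> n *\<^sub>R w \<in> S" for n
      using S y(3) wS \<mu>[of n] by (intro convexD) auto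
    show "g ((1 - \<mu> n) *\<^sub>R x + \<mu> n *\<^sub>R w) \<le> (1 - \<mu> n) * m + \<mu> n * C" for n
      using segment \<mu> by blast
    have "(\<lambda>n. (1 - \<mu> n) * m + \<mu> n * C) \<longlonglongrightarrow> (1 - 0) * m + 0 * C"
      by (intro tendsto_intros lim)
    then show "(\<lambda>n. (1 - \<mu> n) * m + \<mu> n * C) \<longlonglongrightarrow> m" by simp
  qed
qed

lemma play_self [simp]: "play i (x $ i) x = x"
  by (simp add: play_def vec_eq_iff)

lemma play_in_profiles: "x \<in> profiles X \<Longrightarrow> y \<in> X i \<Longrightarrow> play i y x \<in> profiles X"
  by (auto simp: profiles_def play_def)

lemma profiles_subset_rival_profiles: "profiles X \<subseteq> rival_profiles X i"
  by (auto simp: profiles_def rival_profiles_def)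

theorem proposition12:
  fixes B X :: "'p::finite \<Rightarrow> 'a::euclidean_space set"
    and M :: "'w measure"
    and Y :: "'p \<Rightarrow> 'b::euclidean_space set"
    and F :: "'p \<Rightarrow> 'b \<Rightarrow> 'a ^ 'p \<Rightarrow> 'w \<Rightarrow> 'b"
    and ft :: "'p \<Rightarrow> 'a ^ 'p \<Rightarrow> 'b \<Rightarrow> 'w \<Rightarrow> real"
    and f :: "'p \<Rightarrow> 'a ^ 'p \<Rightarrow> real"
    and \<alpha> \<beta> :: "'p \<Rightarrow> real" and L0 :: real
    and \<eta> :: "nat \<Rightarrow> real" and xs :: "nat \<Rightarrow> 'a ^ 'p" and x :: "'a ^ 'p"
  assumes coords: "\<And>i. B i \<subseteq> Basis" "\<And>i. B i \<noteq> {}"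
    and strategies: "\<And>i. X i \<subseteq> span (B i)" "\<And>i. closed (X i)" "\<And>i. convex (X i)"
    and prob: "prob_space M"
    and lower_monotone: "\<And>i z \<omega>. z \<in> cost_domain B X i \<Longrightarrow> \<omega> \<in> space M \<Longrightarrow>
          strongly_monotone_on (Y i) (\<lambda>y. F i y z \<omega>)"
    and lower_unique: "\<And>i z \<omega>. z \<in> cost_domain B X i \<Longrightarrow> \<omega> \<in> space M \<Longrightarrow>
          \<exists>!y. VI_solution (Y i) (\<lambda>y. F i y z \<omega>) y"
    and expectation: "\<And>i z. z \<in> cost_domain B X i \<Longrightarrow>
          integrable M (\<lambda>\<omega>. ft i z (lower_level Y F i z \<omega>) \<omega>)"
    and cost: "f = hierarchical_cost M Y F ft"
    and hierarchical_convex: "\<And>i z. z \<in> rival_profiles X i \<Longrightarrow>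
          convex_on (X i) (\<lambda>y. f i (play i y z))"
    and smoothing: "\<And>i z e. z \<in> cost_domain B X i \<Longrightarrow> e > 0 \<Longrightarrow>
          integrable (unit_ball_uniform (B i)) (\<lambda>u. f i (play i (z $ i + e *\<^sub>R u) z))"
    and subgradients_bounded: "\<And>i z d. z \<in> profiles X \<Longrightarrow>
          d \<in> subdifferential (span (B i)) (\<lambda>y. f i (play i y z)) (z $ i) \<Longrightarrow> norm d \<le> L0"
    and constants: "\<And>i. \<alpha> i > 0" "\<And>i. \<beta> i > 0"
    and smoothed_convex: "\<And>i z e. z \<in> rival_profiles X i \<Longrightarrow> e > 0 \<Longrightarrow>
          convex_on (X i) (\<lambda>y. smoothed B f e i (play i y z))"
    and smoothed_gradient: "\<And>i z e. z \<in> rival_profiles X i \<Longrightarrow> e > 0 \<Longrightarrow>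
          lipschitz_gradient_on (span (B i)) (\<alpha> i / e) (X i)
            (\<lambda>y. smoothed B f e i (play i y z))"
    and smoothed_bounds: "\<And>i z e. z \<in> profiles X \<Longrightarrow> e > 0 \<Longrightarrow>
          f i z \<le> smoothed B f e i z \<and> smoothed B f e i z \<le> f i z + e * \<beta> i"
    and eta: "\<And>k. \<eta> k > 0" "\<eta> \<longlonglongrightarrow> 0"
    and equilibria: "\<And>k. nash_equilibrium X (smoothed B f (\<eta> k)) (xs k)"
    and limit: "xs \<longlonglongrightarrow> x" "x \<in> profiles X"
    and strongly_lsc: "\<And>i z. z \<in> rival_profiles X i \<Longrightarrow>
          strongly_lsc_on (X i) (\<lambda>y. f i (play i y z))"
    and rivals_continuous: "\<And>i y. y \<in> X i \<Longrightarrow>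
          continuous_on (rival_profiles X i) (\<lambda>z. f i (play i y z))"
  shows "nash_equilibrium X f x"
proof -
  have xs: "xs k \<in> profiles X" for k
    using equilibria unfolding nash_equilibrium_def by blast
  have rivals: "xs k \<in> rival_profiles X i" "x \<in> rival_profiles X i" for k i
    using xs limit(2) profiles_subset_rival_profiles by blast+
  \<comment> \<open>The own component of \<open>xs k\<close> also moves, but \<open>play\<close>
    overwrites it with the fixed \<open>y\<close>.\<close>
  have lim_rivals: "(\<lambda>k. f i (play i y (xs k))) \<longlonglongrightarrow> f i (play i y x)" if "y \<in> X i" for i y
    using continuous_on_tendsto_compose[OF rivals_continuous[OF that] limit(1)] rivals by simp
  have "f i x \<le> f i (play i y x)" if y: "y \<in> X i" for i y
  proof -
    \<comment> \<open>The moving point is the player's own component of \<open>xs k\<close>; the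
      bound \<open>c\<close> is the cost of deviating to \<open>y\<close> plus the smoothing
      error.\<close>
    have "f i (play i (x $ i) x) \<le> f i (play i y x)"
    proof (rule convex_pointwise_lim_lsc_le[where S = "X i"
          and G = "\<lambda>k v. f i (play i v (xs k))" and g = "\<lambda>v. f i (play i v x)"
          and y = "\<lambda>k. xs k $ i" and c = "\<lambda>k. f i (play i y (xs k)) + \<eta> k * \<beta> i"])
      show "convex (X i)" by (rule strategies)
      show "convex_on (X i) (\<lambda>v. f i (play i v (xs k)))" for k
        by (rule hierarchical_convex[OF rivals(1)])
      show "(\<lambda>k. f i (play i v (xs k))) \<longlonglongrightarrow> f i (play i v x)" if "v \<in> X i" for v
        using that by (rule lim_rivals)
      show "xs k $ i \<in> X i" for k
        using xs by (simp add: profiles_def)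
      show "(\<lambda>k. xs k $ i) \<longlonglongrightarrow> x $ i"
        using limit(1) by (rule tendsto_vec_nth)
      show "x $ i \<in> X i"
        using limit(2) by (simp add: profiles_def)
      then show "lsc_within (X i) (\<lambda>v. f i (play i v x)) (x $ i)"
        using strongly_lsc[OF rivals(2)] unfolding strongly_lsc_on_def by blast
      show "f i (play i (xs k $ i) (xs k)) \<le> f i (play i y (xs k)) + \<eta> k * \<beta> i" for k
      proof -
        \<comment> \<open>Smoothing never lowers the cost, so the error term is paid only on the
          deviation side.\<close>
        have "f i (xs k) \<le> smoothed B f (\<eta> k) i (xs k)"
          using smoothed_bounds xs eta(1) by blast
        also have "\<dots> \<le> smoothed B f (\<eta> k) i (play i y (xs k))"
          using equilibria y unfolding nash_equilibrium_def by blast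
        also have "\<dots> \<le> f i (play i y (xs k)) + \<eta> k * \<beta> i"
          using smoothed_bounds play_in_profiles[OF xs y] eta(1) by blast
        finally show ?thesis by simp
      qed
      have "(\<lambda>k. f i (play i y (xs k)) + \<eta> k * \<beta> i) \<longlonglongrightarrow> f i (play i y x) + 0 * \<beta> i"
        by (intro tendsto_intros lim_rivals y eta(2))
      then show "(\<lambda>k. f i (play i y (xs k)) + \<eta> k * \<beta> i) \<longlonglongrightarrow> f i (play i y x)" by simp
    qed
    then show ?thesis by simp
  qed
  then show ?thesis
    using limit(2) unfolding nash_equilibrium_def by blast
qed

end
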